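(* Assume the ABC Conjecture over $\mathbb{Z}$. There is an absolute constant $c>0$ such that the following holds. Let $N>0$ be an integer and let $E_N$ be the elliptic curve $y^2=x^3-Nx$ over $\mathbb{Q}$. Let $Q_1\in E_N(\mathbb{Q})$ be a non-torsion point with $x(Q_1)<0$. (1) For every nonzero integer $n$ with $L(nQ_1)\le 1$, we have $h_O(nQ_1)\le c\log N$. (2) Let $Q_2\in E_N(\mathbb{Q})$ be such that $Q_1,Q_2$ are linearly independent (no relation $aQ_1+bQ_2=O$ with integers $(a,b)\ne(0,0)$). Assume moreover that either $Q_2=2R$ for some $R\in E_N(\mathbb{Q})$, or $x(Q_2)$ is the square of a rational number. Let $G=\langle Q_1,Q_2\rangle=\{n_1Q_1+n_2Q_2: n_1,n_2\in\mathbb{Z}\}$. Then for every $Q\in G$ with $Q\neq O$ and $L(Q)\le 1$ we have $h_O(Q)\le c\log N$.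
   Context: ABC Conjecture over $\mathbb{Z}$: for every $\epsilon>0$ there is a constant $K_\epsilon$ such that for all coprime integers $a,b,c$ with $a+b=c$ one has $\max(|a|,|b|,|c|)\le K_\epsilon\,\mathrm{rad}(abc)^{1+\epsilon}$, where $\mathrm{rad}(m)$ is the product of the distinct primes dividing $m$. The constant $c$ may depend on the constants $K_\epsilon$ of the ABC Conjecture, but not on $N$, the points, or the integers $n,n_1,n_2$. $O$ denotes the point at infinity. For a rational point $Q\ne O$, $h_O(Q)=\max\{0,\log|x(Q)|\}$. For a rational point $Q\ne O$ on an elliptic curve in Weierstrass form over $\mathbb{Q}$, the length $L(Q)$ is the number of distinct primes $p$ with $|x(Q)|_p>1$, where $|\cdot|_p$ is the usual $p$-adic absolute value. Equivalently, write $x(Q)=A_Q/B_Q^2$ in lowest terms; then $L(Q)$ is the number of distinct prime divisors of $B_Q$. *)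

theory Defs
  imports Complex_Main "HOL-Computational_Algebra.Primes"
begin

datatype ecpt = Inf | Pt rat rat

fun on_curve :: "int \<Rightarrow> ecpt \<Rightarrow> bool" where
  "on_curve N Inf = True"
| "on_curve N (Pt x y) = (y ^ 2 = x ^ 3 - of_int N * x)"

fun ec_add :: "int \<Rightarrow> ecpt \<Rightarrow> ecpt \<Rightarrow> ecpt" where
  "ec_add N Inf Q = Q"
| "ec_add N P Inf = P"
| "ec_add N (Pt x1 y1) (Pt x2 y2) =
     (if x1 = x2 \<and> y1 = - y2 then Inf
      else let l = (if x1 = x2 then (3 * x1 ^ 2 - of_int N) / (2 * y1)
                    else (y2 - y1) / (x2 - x1));
               x3 = l ^ 2 - x1 - x2;
               y3 = l * (x1 - x3) - y1
           in Pt x3 y3)"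

fun ec_neg :: "ecpt \<Rightarrow> ecpt" where
  "ec_neg Inf = Inf"
| "ec_neg (Pt x y) = Pt x (- y)"

fun ec_nmul :: "int \<Rightarrow> nat \<Rightarrow> ecpt \<Rightarrow> ecpt" where
  "ec_nmul N 0 P = Inf"
| "ec_nmul N (Suc n) P = ec_add N P (ec_nmul N n P)"

definition ec_mul :: "int \<Rightarrow> int \<Rightarrow> ecpt \<Rightarrow> ecpt" where
  "ec_mul N n P = (if 0 \<le> n then ec_nmul N (nat n) P else ec_neg (ec_nmul N (nat (- n)) P))"

fun xcoord :: "ecpt \<Rightarrow> rat" where
  "xcoord Inf = 0"
| "xcoord (Pt x y) = x"

definition hO :: "ecpt \<Rightarrow> real" where
  "hO Q = max 0 (ln \<bar>real_of_rat (xcoord Q)\<bar>)"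

text \<open>Length L(Q): number of distinct primes p with |x(Q)|_p > 1, i.e. the number of
  distinct prime divisors of the denominator of x(Q) in lowest terms.\<close>
definition ec_len :: "ecpt \<Rightarrow> nat" where
  "ec_len Q = card (prime_factors (snd (quotient_of (xcoord Q))))"

definition rad :: "int \<Rightarrow> int" where
  "rad m = (\<Prod>p\<in>prime_factors m. p)"

definition abc_conjecture :: bool where
  "abc_conjecture \<longleftrightarrow>
     (\<forall>\<epsilon>::real. \<epsilon> > 0 \<longrightarrow> (\<exists>K::real. \<forall>a b c :: int.
        coprime a b \<and> coprime b c \<and> coprime a c \<and> a + b = c \<longrightarrow>
        real_of_int (max \<bar>a\<bar> (max \<bar>b\<bar> \<bar>c\<bar>)) \<le> K * (real_of_int (rad (a * b * c))) powr (1 + \<epsilon>)))"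

end

theory Submission
  imports Defs "HOL-Computational_Algebra.Nth_Powers"
begin

text \<open>
  The map \<open>\<delta>\<close> with \<open>\<delta>(O) = 1\<close>, \<open>\<delta>(0,0) = -N\<close> and \<open>\<delta>(x,y) = x\<close> otherwise is multiplicative modulo
  rational squares, because the three intersection points of the curve with a line
  \<open>y = l x + n\<close> satisfy \<open>x\<^sub>1 x\<^sub>2 x\<^sub>3 = n\<^sup>2\<close>. As \<open>\<delta>(Q\<^sub>2)\<close> is a square, \<open>\<delta>(n\<^sub>1 Q\<^sub>1 + n\<^sub>2 Q\<^sub>2)\<close> is
  negative for odd \<open>n\<^sub>1\<close>, so that \<open>-\<surd>N \<le> x(Q) \<le> 0\<close>, and a square for even \<open>n\<^sub>1\<close>.

  In the latter case \<open>x(Q) = a\<^sup>2 / B\<^sup>2\<close> with \<open>a\<^sup>4 - N B\<^sup>4 = c\<^sup>2\<close>, that is, \<open>u v = N B\<^sup>4\<close> and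
  \<open>u + v = 2 a\<^sup>2\<close> for \<open>u = a\<^sup>2 - c\<close>, \<open>v = a\<^sup>2 + c\<close>. Since \<open>B\<close> is a prime power, \<open>B\<^sup>4\<close> divides \<open>2 u\<close>
  or \<open>2 v\<close>, so one of \<open>u\<close>, \<open>v\<close> is at most \<open>2 N\<close>. If it is \<open>v\<close>, then \<open>a\<^sup>2 \<le> 2 N\<close>; if it is \<open>u\<close>,
  the ABC bound for \<open>u\<^sup>2 + N B\<^sup>4 = 2 u a\<^sup>2\<close>, in which \<open>a\<close> has size about \<open>B\<^sup>2\<close>, reads
  \<open>B\<^sup>4 \<le> N\<^bsup>O(1)\<^esup> B\<^bsup>3(1+\<epsilon>)\<^esup>\<close> and bounds \<open>B\<close>. Multiplicative constants are absorbed into powers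
  of \<open>N \<ge> 2\<close>; for \<open>N = 1\<close> there is no point \<open>Q\<^sub>1\<close>, by Fermat's theorem on \<open>x\<^sup>4 - y\<^sup>4 = z\<^sup>2\<close>.
\<close>

section \<open>Fermat's theorem on differences of fourth powers\<close>

lemma coprime_mult_eq_square_nat:
  fixes a b c :: nat
  assumes "coprime a b" "a * b = c ^ 2"
  obtains r s where "a = r ^ 2" "b = s ^ 2" "c = r * s"
proof -
  have "is_nth_power 2 (a * b)" using assms(2) by (auto simp: is_nth_power_def)
  then have "is_nth_power 2 a" "is_nth_power 2 b"
    using is_nth_power_mult_coprime_natD[OF assms(1), of 2]
    by (cases "a = 0 \<or> b = 0"; use assms in auto)+
  then obtain r s where rs: "a = r ^ 2" "b = s ^ 2" by (auto simp: is_nth_power_def)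
  then have "(r * s) ^ 2 = c ^ 2" using assms(2) by (simp add: power_mult_distrib)
  then have "c = r * s" by simp
  with rs that show thesis by blast
qed

lemma coprime_if_no_common_prime_nat:
  fixes a b :: nat
  assumes "\<And>p. prime p \<Longrightarrow> p dvd a \<Longrightarrow> p dvd b \<Longrightarrow> False"
  shows "coprime a b"
proof (rule ccontr)
  assume "\<not> coprime a b"
  then have "gcd a b \<noteq> 1" by (simp add: coprime_iff_gcd_eq_1)
  then obtain p where "prime p" "p dvd gcd a b" using prime_factor_nat by blast
  then show False using assms[of p] by simp
qed

text \<open>The numbers (z - y)/2 and (z + y)/2 are coprime with product (x/2)^2, hence both
  squares. The relation y = r^2 - s^2 is stated without subtraction because the variables are
  naturals.\<close>

lemma primitive_pythagorean_triple:
  fixes x y z :: nat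
  assumes "coprime x y" "x ^ 2 + y ^ 2 = z ^ 2" "even x"
  obtains r s where "x = 2 * (r * s)" "s ^ 2 + y = r ^ 2" "z = r ^ 2 + s ^ 2" "coprime r s"
proof -
  have oy: "odd y" using coprime_common_divisor[OF assms(1,3)] by auto
  have oz: "odd z" using assms(2,3) oy by (metis even_add even_power pos2)
  have "y \<le> z" using assms(2) by (metis le_add2 power2_nat_le_eq_le)
  moreover have "even (z - y)" using oy oz by simp
  ultimately obtain t where t: "z = y + 2 * t" by (metis dvdE le_add_diff_inverse)
  obtain w where w: "x = 2 * w" using assms(3) by blast
  have eq: "t * (t + y) = w ^ 2"
    using assms(2) unfolding t w by (simp add: power2_eq_square algebra_simps)
  have "coprime t (t + y)"
  proof (rule coprime_if_no_common_prime_nat)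
    fix p assume p: "prime p" "p dvd t" "p dvd t + y"
    then have "p dvd y" by (simp add: dvd_add_right_iff)
    moreover have "p dvd w" using p eq by (metis dvd_mult2 prime_dvd_power)
    ultimately show False using coprime_common_divisor[OF assms(1), of p] w p(1) by auto
  qed
  then obtain s r where rs: "t = s ^ 2" "t + y = r ^ 2" "w = s * r"
    using coprime_mult_eq_square_nat eq by metis
  have "coprime r s" using \<open>coprime t (t + y)\<close> rs by (simp add: coprime_commute)
  then show thesis using that[of r s] rs t w by (simp add: mult.commute)
qed

text \<open>Infinite descent on \<open>x\<close>: a common prime is cancelled, and for coprime
  \<open>x\<close>, \<open>y\<close> the Pythagorean triple formed by y^2, z, x^2 produces a
  solution with smaller \<open>x\<close>. Its even leg is y^2 or z, which gives two cases.\<close>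

lemma no_difference_of_fourth_powers_square:
  fixes x y z :: nat
  assumes "x ^ 4 = y ^ 4 + z ^ 2" "y > 0" "z > 0"
  shows False
  using assms
proof (induction x arbitrary: y z rule: less_induct)
  case (less x)
  have sq: "x ^ 4 = (x ^ 2) ^ 2" "y ^ 4 = (y ^ 2) ^ 2" by simp_all
  have xpos: "x > 0" using less.prems by (cases "x = 0") auto
  show False
  proof (cases "coprime x y")
    case False
    then obtain p where p: "prime p" "p dvd x" "p dvd y"
      using coprime_if_no_common_prime_nat by blast
    then obtain x' y' where xy: "x = p * x'" "y = p * y'" by (auto elim!: dvdE)
    \<comment> \<open>The smaller solution is (x/p, y/p, z/p^2).\<close>
    have "p ^ 4 dvd x ^ 4" "p ^ 4 dvd y ^ 4"
      unfolding xy by (auto simp: power_mult_distrib)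
    then have "p ^ 4 dvd y ^ 4 + z ^ 2" "p ^ 4 dvd y ^ 4"
      using less.prems(1) by simp_all
    then have "p ^ 4 dvd z ^ 2" by (simp add: dvd_add_right_iff)
    then have "(p ^ 2) ^ 2 dvd z ^ 2" by simp
    then have "p ^ 2 dvd z" by (subst (asm) pow_divides_pow_iff) auto
    then obtain z' where z: "z = p ^ 2 * z'" by blast
    have "p ^ 4 * x' ^ 4 = p ^ 4 * (y' ^ 4 + z' ^ 2)"
      using less.prems(1) unfolding xy z
      by (simp add: power_mult_distrib algebra_simps flip: power_mult)
    then have "x' ^ 4 = y' ^ 4 + z' ^ 2" using p(1) by auto
    moreover have "x' < x" using xy xpos prime_gt_1_nat[OF p(1)] by simp
    moreover have "y' > 0" "z' > 0" using less.prems xy z by auto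
    ultimately show False using less.IH by blast
  next
    case True
    have cyz: "coprime (y ^ 2) z"
    proof (rule coprime_if_no_common_prime_nat)
      fix p assume p: "prime p" "p dvd y ^ 2" "p dvd z"
      then have "p dvd y" by (rule_tac prime_dvd_power)
      moreover have "p dvd y ^ 4 + z ^ 2" using p \<open>p dvd y\<close> by (simp add: dvd_power_le power2_eq_square numeral_eq_Suc)
      then have "p dvd x" unfolding less.prems(1)[symmetric] using p(1) by (rule_tac prime_dvd_power)
      ultimately show False using coprime_common_divisor[OF True, of p] p(1) by auto
    qed
    show False
    proof (cases "even y")
      case True
      have "(y ^ 2) ^ 2 + z ^ 2 = (x ^ 2) ^ 2" "even (y ^ 2)"
        using less.prems(1) True by simp_all
      then obtain a b where "y ^ 2 = 2 * (a * b)" "b ^ 2 + z = a ^ 2" "x ^ 2 = a ^ 2 + b ^ 2" "coprime a b"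
        by (rule primitive_pythagorean_triple[OF cyz])
      note ab = this(1,3,4)
      obtain h where h: "y = 2 * h" using True by blast
      have h2: "2 * h ^ 2 = a * b" using ab(1) unfolding h by (simp add: power2_eq_square)
      then have "even a \<or> even b" by (metis dvd_triv_left even_mult_iff)
      \<comment> \<open>The even one of \<open>a\<close>, \<open>b\<close> is written 2f and the
        other is d; x^2 = a^2 + b^2 is symmetric in them.\<close>
      then obtain f d where fd: "h ^ 2 = f * d" "x ^ 2 = (2 * f) ^ 2 + d ^ 2" "coprime (2 * f) d"
      proof
        assume "even a"
        then obtain f where "a = 2 * f" by blast
        then show thesis using that[of f b] h2 ab by simp
      next
        assume "even b"
        then obtain f where "b = 2 * f" by blast
        then show thesis using that[of f a] h2 ab by (simp add: coprime_commute add.commute mult.commute)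
      qed
      have "coprime f d" using fd(3) by simp
      then obtain u v where uv: "f = u ^ 2" "d = v ^ 2" "h = u * v"
        using coprime_mult_eq_square_nat fd(1) by metis
      have upos: "u > 0" "v > 0" using uv h less.prems(2) by auto
      \<comment> \<open>A second triple, with legs 2u^2 and v^2 and hypotenuse x. Its parameters
        have product u^2, so they are squares m^2 and n^2, and m^4 - n^4 = v^2.\<close>
      have "coprime (2 * u ^ 2) (v ^ 2)" "(2 * u ^ 2) ^ 2 + (v ^ 2) ^ 2 = x ^ 2" "even (2 * u ^ 2)"
        using fd uv by simp_all
      then obtain r s where rs: "2 * u ^ 2 = 2 * (r * s)" "s ^ 2 + v ^ 2 = r ^ 2"
        "x = r ^ 2 + s ^ 2" "coprime r s"
        by (rule primitive_pythagorean_triple)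
      have "r * s = u ^ 2" using rs(1) by simp
      with rs(4) obtain m n where mn: "r = m ^ 2" "s = n ^ 2" "u = m * n"
        by (rule coprime_mult_eq_square_nat)
      have eq: "m ^ 4 = n ^ 4 + v ^ 2" using rs(2) mn by simp
      have mpos: "m > 0" "n > 0" using mn upos by auto
      have "m \<le> u ^ 2" using mn mpos by (simp add: power2_eq_square)
      moreover have "(u ^ 2) ^ 2 < x ^ 2" using fd(2) uv upos by (simp add: power_mult_distrib)
      then have "u ^ 2 < x" by (rule power_less_imp_less_base) simp
      ultimately show False using less.IH[of m n v] eq mpos upos by simp
    next
      case False
      have "even z"
      proof (rule ccontr)
        assume "odd z"
        \<comment> \<open>Two odd squares sum to 2 modulo 4, whereas the even number
          \<open>x\<close> has a fourth power divisible by 4.\<close>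
        have "(y ^ 4 + z ^ 2) mod 4 = 2"
        proof -
          obtain i where "y ^ 2 = 2 * i + 1" using False by (metis even_power oddE)
          moreover obtain j where "z = 2 * j + 1" using \<open>odd z\<close> by (metis oddE)
          ultimately have "y ^ 4 + z ^ 2 = 4 * (i ^ 2 + i + j ^ 2 + j) + 2"
            unfolding sq by (simp add: power2_eq_square algebra_simps)
          then show ?thesis by presburger
        qed
        moreover have "even x" using less.prems(1) False \<open>odd z\<close> by (metis even_add even_power)
        then have "4 dvd x ^ 4" by (auto simp: power_mult_distrib elim!: evenE)
        ultimately show False using less.prems(1) by (metis dvd_imp_mod_0 zero_neq_numeral)
      qed
      have "coprime z (y ^ 2)" "z ^ 2 + (y ^ 2) ^ 2 = (x ^ 2) ^ 2"
        using cyz less.prems(1) by (simp_all add: coprime_commute)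
      then obtain a b where ab: "z = 2 * (a * b)" "b ^ 2 + y ^ 2 = a ^ 2"
        "x ^ 2 = a ^ 2 + b ^ 2" "coprime a b"
        using \<open>even z\<close> by (rule primitive_pythagorean_triple)
      have apos: "a > 0" "b > 0" using ab less.prems by auto
      \<comment> \<open>The product of x^2 = a^2 + b^2 and y^2 = a^2 - b^2.\<close>
      have "(x * y) ^ 2 + b ^ 4 = a ^ 4"
      proof -
        have "(A + B) * Y + B * B = A * A" if "B + Y = A" for A B Y :: nat
          using that by (auto simp: algebra_simps)
        from this[OF ab(2)] show ?thesis
          unfolding power_mult_distrib ab(3) by (simp add: power2_eq_square power4_eq_xxxx mult.assoc)
      qed
      moreover have "a ^ 2 < x ^ 2" using ab apos by simp
      then have "a < x" by (rule power_less_imp_less_base) simp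
      ultimately show False using less.IH[of a b "x * y"] apos xpos less.prems by (simp add: add.commute)
    qed
  qed
qed

section \<open>The descent map\<close>

text \<open>This is the 2-descent map attached to the 2-torsion point (0,0). Off x = 0 and y = 0,
  the factors x and x^2 - N of y^2 have the same square class; at x = 0 the second factor, with
  value -N, replaces the first.\<close>

definition descent_image :: "int \<Rightarrow> ecpt \<Rightarrow> rat" where
  "descent_image N P = (case P of Inf \<Rightarrow> 1 | Pt x y \<Rightarrow> if x = 0 then - of_int N else x)"

definition same_square_class :: "rat \<Rightarrow> rat \<Rightarrow> bool" where
  "same_square_class a b \<longleftrightarrow> (\<exists>t. t \<noteq> 0 \<and> a = b * t ^ 2)"

lemma same_square_class_refl: "same_square_class a a"
  unfolding same_square_class_def by (rule exI[of _ 1]) simp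

lemma same_square_class_mult:
  assumes "same_square_class a b" "same_square_class c d"
  shows "same_square_class (a * c) (b * d)"
proof -
  obtain s t where "s \<noteq> 0" "a = b * s ^ 2" "t \<noteq> 0" "c = d * t ^ 2"
    using assms by (auto simp: same_square_class_def)
  then show ?thesis unfolding same_square_class_def
    by (intro exI[of _ "s * t"]) (simp add: power_mult_distrib)
qed

lemma same_square_class_trans [trans]:
  assumes "same_square_class a b" "same_square_class b c"
  shows "same_square_class a c"
proof -
  obtain s t where "s \<noteq> 0" "a = b * s ^ 2" "t \<noteq> 0" "b = c * t ^ 2"
    using assms by (auto simp: same_square_class_def)
  then show ?thesis unfolding same_square_class_def
    by (intro exI[of _ "s * t"]) (simp add: power_mult_distrib)
qed

lemma same_square_class_square: "a \<noteq> 0 \<Longrightarrow> same_square_class (a * a) 1"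
  by (auto simp: same_square_class_def power2_eq_square)

lemma descent_image_nonzero: "N \<noteq> 0 \<Longrightarrow> descent_image N P \<noteq> 0"
  by (cases P) (auto simp: descent_image_def)

text \<open>Substituting the line y = l x + n into the curve gives x^3 - l^2 x^2 - (N + 2 l n) x -
  n^2 = 0. The three equations are Vieta's formulas for its roots, a tangent point counting
  twice.\<close>

lemma chord_tangent_vieta:
  assumes "on_curve N (Pt x1 y1)" "on_curve N (Pt x2 y2)" "\<not> (x1 = x2 \<and> y1 = - y2)"
  obtains l n x3 where
    "ec_add N (Pt x1 y1) (Pt x2 y2) = Pt x3 (- (l * x3 + n))"
    "x1 + x2 + x3 = l ^ 2"
    "x1 * x2 + x1 * x3 + x2 * x3 = - of_int N - 2 * l * n"
    "x1 * x2 * x3 = n ^ 2"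
proof -
  define l where "l = (if x1 = x2 then (3 * x1 ^ 2 - of_int N) / (2 * y1) else (y2 - y1) / (x2 - x1))"
  define n where "n = y1 - l * x1"
  define x3 where "x3 = l ^ 2 - x1 - x2"
  define M :: rat where "M = of_int N"
  have c1: "y1 ^ 2 = x1 ^ 3 - M * x1" and c2: "y2 ^ 2 = x2 ^ 3 - M * x2"
    using assms by (auto simp: M_def)
  have add: "ec_add N (Pt x1 y1) (Pt x2 y2) = Pt x3 (- (l * x3 + n))"
    using assms(3) by (simp add: l_def[symmetric] x3_def n_def Let_def algebra_simps)
  have y1: "y1 = l * x1 + n" by (simp add: n_def)
  have e1: "x1 + x2 + x3 = l ^ 2" by (simp add: x3_def)
  have e2: "x1 * x2 + x1 * x3 + x2 * x3 = - M - 2 * l * n"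
  proof (cases "x1 = x2")
    case True
    then have "y1 ^ 2 = y2 ^ 2" using c1 c2 by simp
    \<comment> \<open>Equal abscissas leave y1 = y2 or y1 = -y2, and the latter is excluded; so y1 =
      y2 is nonzero and the tangent slope has a genuine denominator.\<close>
    then have "y1 \<noteq> 0" using assms(3) True by (auto simp: power2_eq_iff)
    then have "2 * y1 * l = 3 * x1 ^ 2 - M" using True by (simp add: l_def M_def)
    then show ?thesis using True unfolding x3_def n_def
      by (simp add: power2_eq_square algebra_simps)
  next
    case False
    then have "l * (x2 - x1) = y2 - y1" by (simp add: l_def)
    then have y2: "y2 = l * x2 + n" by (simp add: n_def algebra_simps)
    have "(x1 - x2) * (x1 * x2 + x1 * x3 + x2 * x3) = (x1 - x2) * (- M - 2 * l * n)"
      using c1 c2 unfolding y1 y2 x3_def by algebra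
    then show ?thesis using False by simp
  qed
  have e3: "x1 * x2 * x3 = n ^ 2" using c1 e1 e2 unfolding y1 by algebra
  show thesis using that[OF add e1 _ e3] e2 by (simp add: M_def)
qed

lemma on_curve_ec_add:
  assumes "on_curve N P" "on_curve N Q"
  shows "on_curve N (ec_add N P Q)"
proof (cases "P = Inf \<or> Q = Inf \<or> P = ec_neg Q")
  case True
  then show ?thesis using assms by (cases P; cases Q) auto
next
  case False
  then obtain x1 y1 x2 y2 where PQ: "P = Pt x1 y1" "Q = Pt x2 y2"
    by (cases P; cases Q) auto
  then have "\<not> (x1 = x2 \<and> y1 = - y2)" using False by simp
  from chord_tangent_vieta[OF assms[unfolded PQ] this] obtain l n x3 where
    "ec_add N P Q = Pt x3 (- (l * x3 + n))" and
    e: "x1 + x2 + x3 = l ^ 2"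
    "x1 * x2 + x1 * x3 + x2 * x3 = - of_int N - 2 * l * n"
    "x1 * x2 * x3 = n ^ 2" unfolding PQ by metis
  moreover have "(l * x3 + n) ^ 2 = x3 ^ 3 - of_int N * x3"
    using e by algebra
  ultimately show ?thesis by (simp only: on_curve.simps power2_minus)
qed

text \<open>If no abscissa vanishes, x1 x2 x3 = n^2 suffices. If one vanishes, then n = 0 and the
  second Vieta formula makes the product of the other two equal to -N, the value assigned to
  (0,0).\<close>

lemma descent_image_ec_add:
  assumes "N \<noteq> 0" "on_curve N P" "on_curve N Q"
  shows "same_square_class (descent_image N (ec_add N P Q)) (descent_image N P * descent_image N Q)"
proof (cases "P = Inf \<or> Q = Inf \<or> P = ec_neg Q")
  case True
  have "same_square_class 1 (a * a)" if "a \<noteq> 0" for a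
    unfolding same_square_class_def using that
    by (intro exI[of _ "1 / a"]) (simp add: power2_eq_square)
  then show ?thesis using True assms(1)
    by (cases P; cases Q) (auto simp: descent_image_def same_square_class_refl)
next
  case False
  then obtain x1 y1 x2 y2 where PQ: "P = Pt x1 y1" "Q = Pt x2 y2"
    by (cases P; cases Q) auto
  then have neq: "\<not> (x1 = x2 \<and> y1 = - y2)" using False by simp
  from chord_tangent_vieta[OF assms(2,3)[unfolded PQ] this] obtain l n x3 where
    add: "ec_add N P Q = Pt x3 (- (l * x3 + n))" and
    e: "x1 * x2 + x1 * x3 + x2 * x3 = - of_int N - 2 * l * n" "x1 * x2 * x3 = n ^ 2"
    unfolding PQ by metis
  have M: "(of_int N :: rat) \<noteq> 0" using assms(1) by simp
  have not00: "\<not> (x1 = 0 \<and> x2 = 0)" using assms(2,3) neq unfolding PQ by auto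
  define d where "d x = (if x = 0 then - of_int N else x :: rat)" for x
  have "\<exists>t. t \<noteq> 0 \<and> d x1 * d x2 = d x3 * t ^ 2"
  proof -
    consider "x1 = 0" | "x1 \<noteq> 0" "x2 = 0" | "x1 \<noteq> 0" "x2 \<noteq> 0" "x3 = 0" | "x1 \<noteq> 0" "x2 \<noteq> 0" "x3 \<noteq> 0"
      by blast
    then show ?thesis
    proof cases
      case 1
      then have "n = 0" and N: "of_int N = - (x2 * x3)" using e by auto
      then show ?thesis using 1 not00 M
        by (intro exI[of _ x2]) (auto simp: d_def N power2_eq_square)
    next
      case 2
      then have "n = 0" and N: "of_int N = - (x1 * x3)" using e by auto
      then show ?thesis using 2 M
        by (intro exI[of _ x1]) (auto simp: d_def N power2_eq_square)
    next
      case 3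
      then have "n = 0" "x1 * x2 = - of_int N" using e by auto
      then show ?thesis using 3 M by (intro exI[of _ 1]) (auto simp: d_def)
    next
      case 4
      then have "n \<noteq> 0" using e by auto
      then show ?thesis using 4 e(2)
        by (intro exI[of _ "n / x3"]) (auto simp: d_def field_simps power2_eq_square)
    qed
  qed
  then obtain t where "t \<noteq> 0" "d x1 * d x2 = d x3 * t ^ 2" by blast
  then have "1 / t \<noteq> 0" "d x3 = d x1 * d x2 * (1 / t) ^ 2"
    by (simp_all add: field_simps)
  moreover have "descent_image N (ec_add N P Q) = d x3"
    "descent_image N P = d x1" "descent_image N Q = d x2"
    unfolding add by (simp_all add: PQ d_def descent_image_def)
  ultimately show ?thesis unfolding same_square_class_def by metis
qed

lemma on_curve_ec_neg: "on_curve N (ec_neg P) = on_curve N P"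
  by (cases P) auto

lemma descent_image_ec_neg: "descent_image N (ec_neg P) = descent_image N P"
  by (cases P) (auto simp: descent_image_def)

lemma on_curve_ec_mul: "on_curve N P \<Longrightarrow> on_curve N (ec_mul N m P)"
proof -
  assume "on_curve N P"
  then have "on_curve N (ec_nmul N k P)" for k
    by (induction k) (auto intro: on_curve_ec_add)
  then show ?thesis by (simp add: ec_mul_def on_curve_ec_neg)
qed

lemma descent_image_ec_mul:
  assumes "N \<noteq> 0" "on_curve N P"
  shows "same_square_class (descent_image N (ec_mul N m P)) (if even m then 1 else descent_image N P)"
proof -
  have on: "on_curve N (ec_nmul N k P)" for k
    using assms(2) by (induction k) (auto intro: on_curve_ec_add)
  have n: "same_square_class (descent_image N (ec_nmul N k P)) (if even k then 1 else descent_image N P)" for k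
  proof (induction k)
    case 0
    show ?case by (simp add: descent_image_def same_square_class_refl)
  next
    case (Suc k)
    have "same_square_class (descent_image N (ec_nmul N (Suc k) P))
      (descent_image N P * descent_image N (ec_nmul N k P))"
      using descent_image_ec_add[OF assms on] by simp
    also have "same_square_class \<dots> (descent_image N P * (if even k then 1 else descent_image N P))"
      using Suc by (rule same_square_class_mult[OF same_square_class_refl])
    also have "same_square_class \<dots> (if even (Suc k) then 1 else descent_image N P)"
      using same_square_class_square[OF descent_image_nonzero[OF assms(1)]]
      by (auto simp: same_square_class_refl)
    finally show ?case .
  qed
  show ?thesis using n[of "nat m"] n[of "nat (- m)"]
    by (cases "m \<ge> 0") (auto simp: ec_mul_def descent_image_ec_neg even_nat_iff split: if_splits)
qed

text \<open>For x < 0, the inequality 0 \<le> y^2 = x (x^2 - N) forces x^2 \<le> N. The point (0,0)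
  also has a negative image.\<close>

lemma xcoord_square_le:
  assumes "on_curve N Q" "N > 0" "descent_image N Q < 0"
  shows "(xcoord Q) ^ 2 \<le> of_int N"
proof (cases Q)
  case Inf
  then show ?thesis using assms by simp
next
  case (Pt x y)
  show ?thesis
  proof (cases "x = 0")
    case True
    then show ?thesis using Pt assms by simp
  next
    case False
    then have "x < 0" using assms Pt by (simp add: descent_image_def)
    have "0 \<le> y ^ 2" by simp
    also have "y ^ 2 = x * (x ^ 2 - of_int N)"
      using assms(1) Pt by (simp add: power2_eq_square power3_eq_cube algebra_simps)
    finally have "x ^ 2 - of_int N \<le> 0" using \<open>x < 0\<close> by (simp add: zero_le_mult_iff)
    then show ?thesis using Pt by simp
  qed
qed

section \<open>The quartic equation under the ABC bound\<close>

lemma rad_le: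
  assumes "n > 0" "\<And>p. prime p \<Longrightarrow> p dvd m \<Longrightarrow> p dvd n"
  shows "rad m \<le> n"
\<comment> \<open>\<open>prime_factors 0\<close> is empty, so \<open>rad 0\<close> is the empty
  product 1.\<close>
proof (cases "m = 0")
  case True
  then show ?thesis using assms(1) by (simp add: rad_def)
next
  case False
  have sub: "prime_factors m \<subseteq> prime_factors n"
    using assms by (auto simp: prime_factors_dvd)
  have pos: "1 \<le> p" if "p \<in> prime_factors n" for p
    using prime_gt_1_int[OF in_prime_factors_imp_prime[OF that]] by simp
  have "rad m \<le> (\<Prod>p\<in>prime_factors n. p)"
    unfolding rad_def using sub pos by (intro prod_mono2) (auto intro: order_trans[OF zero_le_one])
  also have "\<dots> \<le> (\<Prod>p\<in>prime_factors n. p ^ multiplicity p n)"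
  proof (rule prod_mono, safe)
    fix p assume p: "p \<in> prime_factors n"
    show "0 \<le> p" using pos[OF p] by simp
    have "multiplicity p n > 0" using p by (simp add: prime_factors_multiplicity)
    then show "p \<le> p ^ multiplicity p n" using pos[OF p] by (intro self_le_power) auto
  qed
  also have "\<dots> = n" using prime_factorization_int[OF assms(1)] by simp
  finally show ?thesis .
qed

lemma rad_nonneg: "rad m \<ge> 0"
  unfolding rad_def by (rule prod_nonneg) (auto simp: prime_ge_0_int)

lemma prime_power_if_single_prime_factor:
  fixes B :: int
  assumes "B > 0" "card (prime_factors B) \<le> 1"
  obtains p k where "prime p" "B = p ^ k"
proof (cases "prime_factors B = {}")
  case True
  then have "B = 1" using prime_factorization_int[OF assms(1)] by simp
  then show ?thesis using that[of 2 0] by simp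
next
  case False
  then have "card (prime_factors B) = 1" using assms(2)
    by (metis card_0_eq finite_set_mset le_antisym less_one not_le)
  then obtain p where p: "prime_factors B = {p}" by (auto simp: card_1_singleton_iff)
  then have "prime p" by (metis in_prime_factors_imp_prime singletonI)
  moreover have "B = p ^ multiplicity p B" using prime_factorization_int[OF assms(1)] p by simp
  ultimately show ?thesis using that by blast
qed

text \<open>If \<open>p\<close> misses one factor, B^4 divides the other. If \<open>p\<close>
  divides both, it divides 2a^2 but not \<open>a\<close>, so p = 2; the halves of \<open>u\<close>
  and \<open>v\<close> then sum to the odd number a^2, so one half is odd and B^4 divides twice the
  other factor.\<close>

lemma dvd_twice_factor_of_square_sum:
  fixes a u v B :: int
  assumes "prime p" "B = p ^ k" "coprime a B" "B ^ 4 dvd u * v" "u + v = 2 * a ^ 2"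
  shows "B ^ 4 dvd 2 * u \<or> B ^ 4 dvd 2 * v"
proof -
  have cop: "coprime (B ^ 4) w" if "\<not> p dvd w" for w
    using that assms(1,2) by (simp add: prime_imp_coprime coprime_power_left_iff)
  consider "k = 0" | "\<not> p dvd u" | "\<not> p dvd v" | "k > 0" "p dvd u" "p dvd v" by blast
  then show ?thesis
  proof cases
    case 1
    then show ?thesis using assms(2) by simp
  next
    case 2
    then show ?thesis using cop[of u] assms(4) by (simp add: coprime_dvd_mult_right_iff)
  next
    case 3
    then show ?thesis using cop[of v] assms(4) by (simp add: coprime_dvd_mult_left_iff)
  next
    case 4
    have pB: "p dvd B" using 4 assms(2) by (simp add: dvd_power)
    then have pa: "\<not> p dvd a"
      using coprime_common_divisor[OF assms(3), of p] assms(1) by (meson not_prime_unit)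
    have "p dvd 2 * a ^ 2" using 4 unfolding assms(5)[symmetric] by simp
    then have "p dvd 2" using pa assms(1) by (meson prime_dvd_mult_iff prime_dvd_power)
    then have p: "p = 2" using assms(1) by (simp add: primes_dvd_imp_eq)
    obtain u' v' where uv: "u = 2 * u'" "v = 2 * v'" using 4 p by (auto elim!: dvdE)
    then have "u' + v' = a ^ 2" using assms(5) by simp
    then have "\<not> p dvd u' \<or> \<not> p dvd v'" using pa p by (metis dvd_add even_power)
    moreover have "u * v = u' * (2 * v)" "u * v = 2 * u * v'" by (simp_all add: uv)
    ultimately show ?thesis using cop[of u'] cop[of v'] assms(4)
      by (metis coprime_dvd_mult_left_iff coprime_dvd_mult_right_iff)
  qed
qed

definition abc_bound :: "real \<Rightarrow> real \<Rightarrow> bool" where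
  "abc_bound K e \<longleftrightarrow> (\<forall>a b c :: int.
     coprime a b \<and> coprime b c \<and> coprime a c \<and> a + b = c \<longrightarrow>
     real_of_int (max \<bar>a\<bar> (max \<bar>b\<bar> \<bar>c\<bar>)) \<le> K * (real_of_int (rad (a * b * c))) powr (1 + e))"

text \<open>Division by g = gcd(a, b) makes the triple coprime, at the cost of a factor g \<le> a.
  This is cheap when \<open>a\<close> is the small term. \<open>R\<close> dominates the radical
  because it contains every prime of a b c.\<close>

lemma abc_bound_common_factor:
  fixes a b c R :: int
  assumes "abc_bound K e"
    and "K \<ge> 0" "e \<ge> 0"
    and "a > 0" "a + b = c" "R > 0" "\<And>p. prime p \<Longrightarrow> p dvd a * b * c \<Longrightarrow> p dvd R"
  shows "real_of_int b \<le> real_of_int a * (K * real_of_int R powr (1 + e))"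
proof -
  define g where "g = gcd a b"
  have g: "g > 0" "g \<le> a" using assms(4) by (auto simp: g_def gcd_le1_int)
  define a' b' where "a' = a div g" and "b' = b div g"
  have ab: "a = g * a'" "b = g * b'" "coprime a' b'"
    using assms(4) by (simp_all add: a'_def b'_def g_def div_gcd_coprime)
  define c' where "c' = a' + b'"
  have c: "c = g * c'" using assms(5) ab by (simp add: c'_def distrib_left)
  have cop: "coprime b' c'" "coprime a' c'"
    using ab(3) by (simp_all add: c'_def coprime_iff_gcd_eq_1 gcd.commute[of b'])
  have "rad (a' * b' * c') \<le> R"
    by (rule rad_le[OF assms(6)], rule assms(7)) (auto simp: ab(1,2) c prime_dvd_mult_iff)
  have "real_of_int \<bar>b'\<bar> \<le> real_of_int (max \<bar>a'\<bar> (max \<bar>b'\<bar> \<bar>c'\<bar>))" by simp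
  also have "\<dots> \<le> K * real_of_int (rad (a' * b' * c')) powr (1 + e)"
    using assms(1) ab(3) cop unfolding abc_bound_def c'_def by blast
  also have "\<dots> \<le> K * real_of_int R powr (1 + e)"
    using \<open>rad (a' * b' * c') \<le> R\<close> assms(2,3) rad_nonneg
    by (intro mult_left_mono powr_mono2) auto
  finally have *: "real_of_int \<bar>b'\<bar> \<le> K * real_of_int R powr (1 + e)" .
  have "real_of_int b \<le> real_of_int g * real_of_int \<bar>b'\<bar>" using g(1) by (simp add: ab)
  also have "\<dots> \<le> real_of_int a * (K * real_of_int R powr (1 + e))"
    using g * by (intro mult_mono) auto
  finally show ?thesis .
qed

lemma quartic_solution_bound:
  fixes a B c N :: int
  assumes K: "abc_bound K (1/6)"
    and "K \<ge> 1" and N: "N \<ge> 2"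
    and aB: "a > 0" "B > 0" "coprime a B" "card (prime_factors B) \<le> 1"
    and c: "c \<ge> 0" "a ^ 4 = N * B ^ 4 + c ^ 2"
  shows "2 * ln (real_of_int a) - 2 * ln (real_of_int B) \<le> (50 + 4 * ln K / ln 2) * ln (real_of_int N)"
proof -
  define u v where "u = a ^ 2 - c" and "v = a ^ 2 + c"
  have uv: "u * v = N * B ^ 4"
    using c(2) by (simp add: u_def v_def power2_eq_square power4_eq_xxxx algebra_simps)
  have NB: "N * B ^ 4 > 0" using N aB by simp
  have v: "v > 0" "v \<ge> a ^ 2" using aB c by (auto simp: v_def add_pos_nonneg)
  have u: "u > 0" using uv NB v(1) by (metis zero_less_mult_pos2)
  have sum: "u + v = 2 * a ^ 2" by (simp add: u_def v_def)
  obtain p k where pk: "prime p" "B = p ^ k"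
    using prime_power_if_single_prime_factor[OF aB(2,4)] .
  have "B ^ 4 dvd u * v" by (simp add: uv)
  then have or: "B ^ 4 dvd 2 * u \<or> B ^ 4 dvd 2 * v"
    using dvd_twice_factor_of_square_sum[OF pk aB(3)] sum by blast
  \<comment> \<open>From B^4 \<le> 2w, the cofactor of \<open>w\<close> in N B^4 is at most
    2N.\<close>
  have small: "w' \<le> 2 * N" if "w > 0" "w' > 0" "w * w' = N * B ^ 4" "B ^ 4 dvd 2 * w" for w w' :: int
  proof -
    have "B ^ 4 \<le> 2 * w" using that by (intro zdvd_imp_le) auto
    then have "N * B ^ 4 \<le> N * (2 * w)" using N by simp
    then have "w * w' \<le> w * (2 * N)" using that(3) by (simp add: mult_ac)
    then show ?thesis using that(1) by simp
  qed
  define LN LB LA where "LN = ln (real_of_int N)" and "LB = ln (real_of_int B)" and "LA = ln (real_of_int a)"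
  have ln_mono: "ln (real_of_int s) \<le> ln (real_of_int t)" if "0 < s" "s \<le> t" for s t
    using that by (subst ln_le_cancel_iff) auto
  have LB0: "LB \<ge> 0" using aB by (simp add: LB_def)
  have L2: "ln 2 \<le> LN" using N by (simp add: LN_def)
  have L20: "ln 2 > (0::real)" by simp
  \<comment> \<open>Since ln N \<ge> ln 2, the constant \<open>K\<close> is absorbed into the power
    of \<open>N\<close> with exponent ln K / ln 2.\<close>
  have LK: "ln K \<le> ln K / ln 2 * LN" "ln K / ln 2 * LN \<ge> 0"
  proof -
    have "ln K / ln 2 * ln 2 \<le> ln K / ln 2 * LN" using L2 assms(2) by (intro mult_left_mono) auto
    then show "ln K \<le> ln K / ln 2 * LN" by simp
    show "ln K / ln 2 * LN \<ge> 0" using order_trans[OF less_imp_le[OF L20] L2] assms(2) by (intro mult_nonneg_nonneg) auto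
  qed
  have "2 * LA - 2 * LB \<le> 50 * LN + 4 * (ln K / ln 2 * LN)"
    using or
  proof
    assume "B ^ 4 dvd 2 * u"
    then have "a ^ 2 \<le> 2 * N" using small[of u v] u v uv by linarith
    then have "ln (real_of_int (a ^ 2)) \<le> ln (real_of_int (2 * N))" using aB by (intro ln_mono) auto
    then have "2 * LA \<le> ln 2 + LN" using aB N by (simp add: LA_def LN_def ln_realpow ln_mult)
    then show ?thesis using L2 L20 LB0 LK(2) by linarith
  next
    assume "B ^ 4 dvd 2 * v"
    then have u2: "u \<le> 2 * N" using small[of v u] u v uv by (simp add: mult.commute)
    have "1 * v \<le> u * v" using u v by (intro mult_right_mono) auto
    then have "a ^ 2 \<le> N * B ^ 4" using uv v by linarith
    then have "ln (real_of_int (a ^ 2)) \<le> ln (real_of_int (N * B ^ 4))" using aB by (intro ln_mono) auto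
    then have LA: "2 * LA \<le> LN + 4 * LB" using aB N by (simp add: LA_def LN_def LB_def ln_realpow ln_mult)
    \<comment> \<open>The equation for ABC is u^2 + u v = u (u + v), whose first term is bounded in
      terms of \<open>N\<close>.\<close>
    have eq: "u ^ 2 + N * B ^ 4 = 2 * u * a ^ 2"
      unfolding uv[symmetric] by (simp add: power2_eq_square flip: distrib_left) (simp add: sum power2_eq_square)
    have R: "2 * u * N * B * a > 0" using u N aB by simp
    \<comment> \<open>The radical divides into u, N, B, a and 2. As a is at most
      \<open>sqrt N\<close> times B^2, it contributes about B^3, and the choice e = 1/6 yields
      B^(7/2), still below B^4.\<close>
    have "real_of_int (N * B ^ 4) \<le> real_of_int (u ^ 2) * (K * real_of_int (2 * u * N * B * a) powr (1 + 1/6))"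
    proof (rule abc_bound_common_factor[OF K _ _ _ eq R])
      fix p :: int assume p: "prime p" "p dvd u ^ 2 * (N * B ^ 4) * (2 * u * a ^ 2)"
      then have "p dvd u \<or> p dvd N \<or> p dvd B \<or> p dvd 2 \<or> p dvd a"
        by (auto simp: prime_dvd_mult_iff dest: prime_dvd_power)
      then show "p dvd 2 * u * N * B * a" by auto
    qed (use u assms(2) in auto)
    then have "ln (real_of_int (N * B ^ 4)) \<le> ln (real_of_int (u ^ 2) * (K * real_of_int (2 * u * N * B * a) powr (1 + 1/6)))"
      using NB u assms(2) R by (subst ln_le_cancel_iff) (auto intro!: mult_pos_pos simp del: of_int_mult)
    also have "\<dots> = ln (real_of_int (u ^ 2)) + (ln K + 7/6 * ln (real_of_int (2 * u * N * B * a)))"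
    proof -
      have "ln (s * (K * t powr (1 + 1/6))) = ln s + (ln K + 7/6 * ln t)" if "s > 0" "t > 0" for s t
        using that assms(2) by (simp add: ln_mult ln_powr)
      moreover have "real_of_int (u ^ 2) > 0" "real_of_int (2 * u * N * B * a) > 0"
        using u R by (simp_all only: of_int_0_less_iff zero_less_power)
      ultimately show ?thesis by blast
    qed
    finally have main: "LN + 4 * LB \<le> 2 * ln (real_of_int u) + ln K + 7/6 * (ln 2 + ln (real_of_int u) + LN + LB + LA)"
      using u N aB by (simp add: LA_def LN_def LB_def ln_realpow ln_mult)
    have "ln (real_of_int u) \<le> ln (real_of_int (2 * N))" using u2 u by (intro ln_mono)
    then have "ln (real_of_int u) \<le> ln 2 + LN" using N by (simp add: LN_def ln_mult)
    \<comment> \<open>With ln 2 \<le> LN, ln u \<le> 2 LN and LA \<le> LN/2 + 2 LB,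
      \<open>main\<close> gives LB \<le> 16.5 LN + 2 ln K. Hence 2 LA - 2 LB \<le> LN + 2 LB \<le>
      34 LN + 4 ln K, which leaves room below 50.\<close>
    then show ?thesis using main LA L2 L20 LB0 LK by argo
  qed
  then show ?thesis by (simp add: LA_def LN_def LB_def algebra_simps)
qed

section \<open>Heights of points of small length\<close>

lemma rat_square_eq_int:
  fixes q :: rat
  assumes "q ^ 2 = of_int m"
  obtains k where "k \<ge> 0" "m = k ^ 2"
proof -
  obtain n d where nd: "quotient_of q = (n, d)" by fastforce
  then have q: "q = of_int n / of_int d" and d: "d > 0" and cop: "coprime n d"
    using quotient_of_div quotient_of_denom_pos quotient_of_coprime by auto
  have "(of_int (n ^ 2) :: rat) = of_int (m * d ^ 2)"
    using assms d by (simp add: q power_divide field_simps)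
  then have eq: "n ^ 2 = m * d ^ 2" by (simp only: of_int_eq_iff)
  then have "d ^ 2 dvd n ^ 2" by simp
  then have "d dvd n" by simp
  then have "is_unit d" by (rule coprime_common_divisor[OF cop _ dvd_refl])
  then have "d = 1" using d by simp
  then show thesis using that[of "\<bar>n\<bar>"] eq by simp
qed

text \<open>Dividing the curve equation by r^2 gives (y/r)^2 = r^4 - N. Multiplication by B^4 turns
  the right side into an integer, and a rational square that is an integer is the square of an
  integer.\<close>

lemma on_curve_square_xcoordE:
  assumes "on_curve N (Pt (r ^ 2) y)" "r \<noteq> 0"
  obtains a B c :: int where "a > 0" "B > 0" "coprime a B" "r ^ 2 = (of_int a / of_int B) ^ 2"
    "snd (quotient_of (r ^ 2)) = B ^ 2" "c \<ge> 0" "a ^ 4 = N * B ^ 4 + c ^ 2"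
proof -
  obtain a B where aB: "quotient_of \<bar>r\<bar> = (a, B)" by fastforce
  then have q: "\<bar>r\<bar> = of_int a / of_int B" and B: "B > 0" and cop: "coprime a B"
    using quotient_of_div quotient_of_denom_pos quotient_of_coprime by auto
  have "of_int a / of_int B > (0 :: rat)" using assms(2) q[symmetric] by simp
  then have a: "a > 0" using B by (simp add: zero_less_divide_iff)
  have r2: "r ^ 2 = (of_int a / of_int B) ^ 2" unfolding q[symmetric] by simp
  then have "r ^ 2 = Fract (a ^ 2) (B ^ 2)" by (simp add: Fract_of_int_quotient power_divide)
  then have snd: "snd (quotient_of (r ^ 2)) = B ^ 2"
    using B cop by (simp add: quotient_of_Fract)
  have "y ^ 2 = r ^ 2 * ((r ^ 2) ^ 2 - of_int N)"
    using assms(1) by (simp add: power3_eq_cube power2_eq_square algebra_simps)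
  then have "(y / r) ^ 2 = (r ^ 2) ^ 2 - of_int N"
    using assms(2) by (simp add: power_divide)
  then have "(y / r * of_int B ^ 2) ^ 2 = ((r ^ 2) ^ 2 - of_int N) * of_int B ^ 4"
    by (simp only: power_mult_distrib) simp
  also have "\<dots> = of_int (a ^ 4 - N * B ^ 4)"
    using B unfolding r2 by (simp add: power_divide field_simps)
  finally obtain c where "c \<ge> 0" "a ^ 4 - N * B ^ 4 = c ^ 2" by (rule rat_square_eq_int)
  then show thesis using that[OF a B cop r2 snd] by simp
qed

lemma same_square_class_neg_iff: "same_square_class a b \<Longrightarrow> a < 0 \<longleftrightarrow> b < 0"
  by (auto simp: same_square_class_def mult_less_0_iff)

lemma hO_le_if_descent_image_neg:
  assumes "on_curve N Q" "N > 0" "descent_image N Q < 0"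
  shows "2 * hO Q \<le> ln (real_of_int N)"
proof -
  define x where "x = real_of_rat (xcoord Q)"
  have "real_of_rat ((xcoord Q) ^ 2) \<le> real_of_rat (of_int N)"
    using xcoord_square_le[OF assms] by (simp only: of_rat_less_eq)
  then have "x ^ 2 \<le> real_of_int N" by (simp add: x_def of_rat_power)
  then have "\<bar>x\<bar> ^ 2 \<le> real_of_int N" by simp
  then have "ln (\<bar>x\<bar> ^ 2) \<le> ln (real_of_int N)" if "x \<noteq> 0"
    using that assms(2) by (subst ln_le_cancel_iff) auto
  then have "2 * ln \<bar>x\<bar> \<le> ln (real_of_int N)" if "x \<noteq> 0"
    using that ln_realpow[of "\<bar>x\<bar>" 2] by simp
  \<comment> \<open>At x = 0 the convention \<open>ln 0 = 0\<close> gives height 0.\<close>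
  then show ?thesis using assms(2) unfolding hO_def x_def[symmetric] by (cases "x = 0") (auto simp: max_def)
qed

lemma hO_le_if_descent_image_square:
  assumes "abc_bound K (1/6)" "K \<ge> 1" "N \<ge> 2"
    and "on_curve N Q" "same_square_class (descent_image N Q) 1" "Q \<noteq> Inf" "ec_len Q \<le> 1"
  shows "hO Q \<le> (50 + 4 * ln K / ln 2) * ln (real_of_int N)"
proof -
  obtain x y where Q: "Q = Pt x y" using assms(6) by (cases Q) auto
  obtain r where r: "r \<noteq> 0" "descent_image N Q = r ^ 2"
    using assms(5) by (auto simp: same_square_class_def)
  then have "descent_image N Q > 0" by simp
  \<comment> \<open>At x = 0 the image would be -N < 0.\<close>
  then have "x \<noteq> 0" using assms(3) by (auto simp: Q descent_image_def)
  then have x: "x = r ^ 2" using r(2) by (simp add: Q descent_image_def)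
  obtain a B c :: int where abc: "a > 0" "B > 0" "coprime a B" "r ^ 2 = (of_int a / of_int B) ^ 2"
    "snd (quotient_of (r ^ 2)) = B ^ 2" "c \<ge> 0" "a ^ 4 = N * B ^ 4 + c ^ 2"
    using on_curve_square_xcoordE[OF _ r(1)] assms(4) unfolding Q x by metis
  have "card (prime_factors B) \<le> 1"
  proof -
    have "prime_factors (B ^ 2) = prime_factors B"
      using abc(2) by (simp add: power2_eq_square prime_factorization_mult)
    then show ?thesis using assms(7) by (simp add: ec_len_def Q x abc(5))
  qed
  from quartic_solution_bound[OF assms(1-3) abc(1-3) this abc(6,7)]
  have "2 * ln (real_of_int a) - 2 * ln (real_of_int B) \<le> (50 + 4 * ln K / ln 2) * ln (real_of_int N)" .
  moreover have "real_of_rat (xcoord Q) = (real_of_int a / real_of_int B) ^ 2"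
    by (simp add: Q x abc(4) of_rat_power of_rat_divide)
  then have "ln \<bar>real_of_rat (xcoord Q)\<bar> = 2 * ln (real_of_int a) - 2 * ln (real_of_int B)"
    using abc(1,2) by (simp add: ln_realpow ln_div)
  moreover have "0 \<le> (50 + 4 * ln K / ln 2) * ln (real_of_int N)"
    using assms(2,3) by (intro mult_nonneg_nonneg add_nonneg_nonneg) auto
  ultimately show ?thesis by (simp add: hO_def)
qed

text \<open>With -x = n/d in lowest terms, n d (d^2 - n^2) is a nonzero square with pairwise coprime
  factors. So n = a^2, d = b^2 and b^4 - a^4 is a nonzero square, against Fermat.\<close>

lemma no_rational_point_on_egg_of_curve_one:
  assumes "y ^ 2 = x ^ 3 - x" "x < 0" "y \<noteq> (0 :: rat)"
  shows False
proof -
  obtain n d where nd: "quotient_of (- x) = (n, d)" by fastforce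
  then have q: "- x = of_int n / of_int d" and d: "d > 0" and cop: "coprime n d"
    using quotient_of_div quotient_of_denom_pos quotient_of_coprime by auto
  have "of_int n / of_int d > (0 :: rat)" using assms(2) q[symmetric] by simp
  then have n: "n > 0" using d by (simp add: zero_less_divide_iff)
  have x: "x = - (of_int n / of_int d)" using q by simp
  have "(y * of_int d ^ 2) ^ 2 = (x ^ 3 - x) * of_int d ^ 4"
    using assms(1) by (simp add: power_mult_distrib)
  also have "\<dots> = of_int (n * d * (d ^ 2 - n ^ 2))"
    using d unfolding x by (simp add: field_simps eval_nat_numeral)
  finally have sq: "(y * of_int d ^ 2) ^ 2 = of_int (n * d * (d ^ 2 - n ^ 2))" .
  then obtain k where k: "k \<ge> 0" "n * d * (d ^ 2 - n ^ 2) = k ^ 2" by (rule rat_square_eq_int)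
  have "y * of_int d ^ 2 \<noteq> 0" using assms(3) d by simp
  then have "k \<noteq> 0" using sq k(2) by auto
  then have "n * d * (d ^ 2 - n ^ 2) > 0" using k by simp
  moreover have "n * d > 0" using n d by simp
  ultimately have "d ^ 2 - n ^ 2 > 0" by (meson zero_less_mult_pos)
  then have "n < d" using d by (intro power_less_imp_less_base[of n 2 d]) auto
  define n' d' e k' where "n' = nat n" and "d' = nat d" and "e = nat (d ^ 2 - n ^ 2)" and "k' = nat k"
  have i: "n = int n'" "d = int d'" "d ^ 2 - n ^ 2 = int e" "k = int k'"
    using n d k(1) \<open>n < d\<close> by (simp_all add: n'_def d'_def e_def k'_def)
  have "int (d' ^ 2) = int (n' ^ 2 + e)" using i(1-3) by simp
  then have de: "d' ^ 2 = n' ^ 2 + e" by (simp only: of_nat_eq_iff)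
  have "int (n' * d' * e) = int (k' ^ 2)" using k(2) unfolding i(3) by (simp add: i)
  then have prod: "(n' * d') * e = k' ^ 2" by (simp only: of_nat_eq_iff)
  have cop': "coprime n' d'" using cop by (simp add: i)
  have "coprime (n' * d') e"
  proof (rule coprime_if_no_common_prime_nat)
    fix p assume p: "prime p" "p dvd n' * d'" "p dvd e"
    then have "p dvd n' \<or> p dvd d'" by (simp add: prime_dvd_mult_iff)
    then have "p dvd n' \<and> p dvd d'"
    proof
      assume *: "p dvd n'"
      then have "p dvd n' ^ 2 + e" using p(3) by (simp add: power2_eq_square)
      then have "p dvd d' ^ 2" by (simp only: de)
      then show ?thesis using * prime_dvd_power[OF p(1)] by blast
    next
      assume *: "p dvd d'"
      then have "p dvd n' ^ 2 + e" unfolding de[symmetric] by (simp add: power2_eq_square)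
      then have "p dvd n' ^ 2" using p(3) by (simp add: dvd_add_left_iff)
      then show ?thesis using * prime_dvd_power[OF p(1)] by blast
    qed
    then show False using coprime_common_divisor[OF cop', of p] p(1) by auto
  qed
  then obtain s t where st: "n' * d' = s ^ 2" "e = t ^ 2"
    using prod by (rule coprime_mult_eq_square_nat)
  obtain a b where ab: "n' = a ^ 2" "d' = b ^ 2"
    using cop' st(1) by (rule coprime_mult_eq_square_nat)
  have "b ^ 4 = a ^ 4 + t ^ 2" using de by (simp add: ab st)
  moreover have "a > 0" using n i ab by (cases a) auto
  moreover have "t > 0" using \<open>d ^ 2 - n ^ 2 > 0\<close> i(3) st by (cases t) auto
  ultimately show False by (rule no_difference_of_fourth_powers_square)
qed

theorem theorem1p2:
  assumes "abc_conjecture"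
  shows "\<exists>C::real. C > 0 \<and>
    (\<forall>(N::int) Q1. N > 0 \<and> on_curve N Q1 \<and> Q1 \<noteq> Inf \<and>
        (\<forall>n::int. n \<noteq> 0 \<longrightarrow> ec_mul N n Q1 \<noteq> Inf) \<and> xcoord Q1 < 0 \<longrightarrow>
       (\<forall>n::int. n \<noteq> 0 \<and> ec_len (ec_mul N n Q1) \<le> 1 \<longrightarrow>
           hO (ec_mul N n Q1) \<le> C * ln (real_of_int N)) \<and>
       (\<forall>Q2. on_curve N Q2 \<and>
            (\<forall>a b :: int. ec_add N (ec_mul N a Q1) (ec_mul N b Q2) = Inf \<longrightarrow> a = 0 \<and> b = 0) \<and>
            ((\<exists>R. on_curve N R \<and> Q2 = ec_add N R R) \<or> (\<exists>r::rat. Q2 \<noteq> Inf \<and> xcoord Q2 = r ^ 2)) \<longrightarrow>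
          (\<forall>Q. (\<exists>n1 n2 :: int. Q = ec_add N (ec_mul N n1 Q1) (ec_mul N n2 Q2)) \<and>
               Q \<noteq> Inf \<and> ec_len Q \<le> 1 \<longrightarrow> hO Q \<le> C * ln (real_of_int N))))"
proof -
  obtain K0 where K0: "abc_bound K0 (1/6)"
    using assms unfolding abc_conjecture_def abc_bound_def
    by (metis zero_less_divide_1_iff zero_less_numeral)
  \<comment> \<open>Enlarging the constant to at least 1 makes ln K nonnegative.\<close>
  define K where "K = max 1 K0"
  have K1: "K \<ge> 1" by (simp add: K_def)
  have "K0 * t powr (1 + 1/6) \<le> K * t powr (1 + 1/6)" for t
    by (intro mult_right_mono) (auto simp: K_def)
  then have K: "abc_bound K (1/6)"
    using K0 unfolding abc_bound_def by (blast intro: order_trans)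
  define C where "C = 50 + 4 * ln K / ln 2"
  have C: "C \<ge> 50" using K1 by (simp add: C_def)
  show ?thesis
  proof (rule exI[of _ C], intro conjI allI impI)
    show "C > 0" using C by simp
  next
    fix N Q1
    assume A: "N > 0 \<and> on_curve N Q1 \<and> Q1 \<noteq> Inf \<and>
      (\<forall>n::int. n \<noteq> 0 \<longrightarrow> ec_mul N n Q1 \<noteq> Inf) \<and> xcoord Q1 < 0"
    then obtain x y where Q1: "Q1 = Pt x y" "x < 0" by (cases Q1) auto
    have dneg: "descent_image N Q1 < 0" using Q1 by (simp add: descent_image_def)
    have "N \<noteq> 1"
    proof
      assume "N = 1"
      then have "y ^ 2 = x ^ 3 - x" using A Q1 by simp
      moreover have "y \<noteq> 0"
      proof
        assume "y = 0"
        \<comment> \<open>A point with y = 0 is 2-torsion.\<close>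
        then have "ec_mul N 2 Q1 = Inf" by (simp add: ec_mul_def Q1 numeral_2_eq_2)
        then show False using A by auto
      qed
      ultimately show False using no_rational_point_on_egg_of_curve_one Q1(2) by blast
    qed
    then have N: "N \<ge> 2" "N > 0" "N \<noteq> 0" using A by auto
    \<comment> \<open>Both claims reduce to this: only the parity of the coefficient
      \<open>n\<close> of \<open>Q1\<close> matters. Odd \<open>n\<close> gives a negative image,
      even \<open>n\<close> a square.\<close>
    have bound: "hO Q \<le> C * ln (real_of_int N)"
      if Q: "on_curve N Q" "Q \<noteq> Inf" "ec_len Q \<le> 1"
        "same_square_class (descent_image N Q) (if even n then 1 else descent_image N Q1)" for Q and n :: int
    proof (cases "even n")
      case True
      then show ?thesis using hO_le_if_descent_image_square[OF K K1 N(1) Q(1) _ Q(2,3)] Q(4)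
        by (simp add: C_def)
    next
      case False
      then have "2 * hO Q \<le> ln (real_of_int N)"
        using Q dneg N by (intro hO_le_if_descent_image_neg) (simp_all add: same_square_class_neg_iff)
      moreover have "1 * ln (real_of_int N) \<le> C * ln (real_of_int N)" "0 \<le> hO Q"
        using C N by (auto intro!: mult_right_mono simp: hO_def)
      ultimately show ?thesis by linarith
    qed
    {
      fix n :: int
      assume "n \<noteq> 0 \<and> ec_len (ec_mul N n Q1) \<le> 1"
      then show "hO (ec_mul N n Q1) \<le> C * ln (real_of_int N)"
        using A N by (intro bound[where n = n] on_curve_ec_mul descent_image_ec_mul) auto
    next
      fix Q2 Q
      assume B: "on_curve N Q2 \<and>
            (\<forall>a b :: int. ec_add N (ec_mul N a Q1) (ec_mul N b Q2) = Inf \<longrightarrow> a = 0 \<and> b = 0) \<and>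
            ((\<exists>R. on_curve N R \<and> Q2 = ec_add N R R) \<or> (\<exists>r::rat. Q2 \<noteq> Inf \<and> xcoord Q2 = r ^ 2))"
        and "(\<exists>n1 n2 :: int. Q = ec_add N (ec_mul N n1 Q1) (ec_mul N n2 Q2)) \<and> Q \<noteq> Inf \<and> ec_len Q \<le> 1"
      then obtain n1 n2 where Q: "Q = ec_add N (ec_mul N n1 Q1) (ec_mul N n2 Q2)" "Q \<noteq> Inf" "ec_len Q \<le> 1"
        by blast
      have Q2: "same_square_class (descent_image N Q2) 1"
      proof (cases "\<exists>R. on_curve N R \<and> Q2 = ec_add N R R")
        case True
        then obtain R where R: "on_curve N R" "Q2 = ec_add N R R" by blast
        then show ?thesis
          using descent_image_ec_add[OF N(3) R(1) R(1)]
            same_square_class_square[OF descent_image_nonzero[OF N(3)]] same_square_class_trans by blast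
      next
        case False
        then obtain r where r: "Q2 \<noteq> Inf" "xcoord Q2 = r ^ 2" using B by blast
        then obtain y2 where y2: "Q2 = Pt (r ^ 2) y2" by (cases Q2) auto
        have "r \<noteq> 0"
        proof
          assume "r = 0"
          then have "Q2 = Pt 0 0" using y2 B by simp
          \<comment> \<open>The 2-torsion point (0,0) would give the relation with coefficients 0
            and 2, against independence.\<close>
          then have "ec_add N (ec_mul N 0 Q1) (ec_mul N 2 Q2) = Inf"
            by (simp add: ec_mul_def numeral_2_eq_2)
          then show False using B by fastforce
        qed
        then show ?thesis by (auto simp: same_square_class_def descent_image_def y2)
      qed
      have on: "on_curve N (ec_mul N n1 Q1)" "on_curve N (ec_mul N n2 Q2)"
        using A B by (auto intro: on_curve_ec_mul)
      have "same_square_class (descent_image N (ec_mul N n2 Q2)) (if even n2 then 1 else descent_image N Q2)"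
        using descent_image_ec_mul N(3) B by blast
      also have "same_square_class \<dots> 1" using Q2 by (simp add: same_square_class_refl)
      finally have n2: "same_square_class (descent_image N (ec_mul N n2 Q2)) 1" .
      have n1: "same_square_class (descent_image N (ec_mul N n1 Q1)) (if even n1 then 1 else descent_image N Q1)"
        using descent_image_ec_mul N(3) A by blast
      have "same_square_class (descent_image N Q)
          (descent_image N (ec_mul N n1 Q1) * descent_image N (ec_mul N n2 Q2))"
        unfolding Q(1) by (rule descent_image_ec_add[OF N(3) on])
      also have "same_square_class \<dots> ((if even n1 then 1 else descent_image N Q1) * 1)"
        by (rule same_square_class_mult[OF n1 n2])
      finally have "same_square_class (descent_image N Q) (if even n1 then 1 else descent_image N Q1)"
        by simp
      then show "hO Q \<le> C * ln (real_of_int N)"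
        using bound[OF _ Q(2,3)] on_curve_ec_add[OF on] Q(1) by blast
    }
  qed
qed

end
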